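(* Fix an integer $k\ge1$. For $n\ge1$ let $P^{(1)}$ be the $n\times n$ matrix with entries \[ a(i,j,n)=\frac{1}{2^i}\binom{i-1}{j-1}+\frac{1}{2^{n-i+1}}\binom{n-i}{j-i}\qquad(1\le i,j\le n), \] with $\binom{a}{b}=0$ if $b<0$ or $b>a$, and let $a^{(k)}_{i,j}$ be the $(i,j)$ entry of $(P^{(1)})^k$. Let \[ E_n=\sum_{i=1}^n\max_{1\le j\le n}a^{(k)}_{i,j}, \] the expected number of correct guesses under the optimal no-feedback guessing strategy for an $n$-card deck after $k$ riffle shuffles. Then, as $n\to\infty$, \[ E_n=\frac{2\sqrt n}{\sqrt{(2^k-1)\pi}}+\mathcal O(1). \]
   Context: A deck of $n$ cards ordered $1,2,\dots,n$ is given $k$ riffle (GSR) shuffles; $a^{(k)}_{i,j}$ is the probability that the card at position $i$ is card number $j$. In the no-feedback game the player fixes a guess for every position in advance and scores one point per correct guess; the optimal strategy guesses, at each position $i$, a $j$ maximizing $a^{(k)}_{i,j}$, so its expected score is $E_n$. *)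

theory Defs
  imports Complex_Main "HOL-Library.Landau_Symbols" "Jordan_Normal_Form.Matrix"
begin

text \<open>Positions and cards are numbered from 1. The \<open>if\<close> implements the convention that
  a binomial coefficient with negative lower index is 0, since subtraction on
  \<^typ>\<open>nat\<close> truncates.\<close>

definition riffle_entry :: "nat \<Rightarrow> nat \<Rightarrow> nat \<Rightarrow> real" where
  "riffle_entry i j n =
     1 / 2 ^ i * real ((i - 1) choose (j - 1))
     + 1 / 2 ^ (n - i + 1) * (if i \<le> j then real ((n - i) choose (j - i)) else 0)"

text \<open>Matrix indices are 0-based, hence the shifts in the next two definitions.\<close>

definition riffle_mat :: "nat \<Rightarrow> real mat" where
  "riffle_mat n = mat n n (\<lambda>(r, c). riffle_entry (r + 1) (c + 1) n)"

definition riffle_prob :: "nat \<Rightarrow> nat \<Rightarrow> nat \<Rightarrow> nat \<Rightarrow> real" where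
  "riffle_prob k n i j = (riffle_mat n ^\<^sub>m k) $$ (i - 1, j - 1)"

definition expected_score :: "nat \<Rightarrow> nat \<Rightarrow> real" where
  "expected_score k n = (\<Sum>i = 1..n. Max ((\<lambda>j. riffle_prob k n i j) ` {1..n}))"

end

theory Submission
  imports Defs "HOL-Analysis.Analysis" "HOL-Probability.Probability_Mass_Function"
    "HOL-Computational_Algebra.Polynomial" "HOL-Real_Asymp.Real_Asymp"
begin

text \<open>
  Put \<open>a = 2^k\<close>. The row with \<open>r\<close> positions before and \<open>s\<close> behind is, in the \<open>k\<close>-th matrix power,
  the uniform mixture over the digits \<open>d < a\<close> of the laws of \<open>Bin(r, (d+1)/a) + Bin(s, d/a)\<close>. The
  means of these components are \<open>(r+s)/a\<close> apart and their variances are at most \<open>(r+s)/4\<close>, so by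
  Chebyshev's inequality at most one component contributes more than \<open>O(1/n)\<close> to any given entry.
  With \<open>m = min r s\<close>, Stirling's formula at the mode of a binomial law bounds the point masses of
  every component by \<open>a / sqrt (2 \<pi> (a-1) m) + O(m^(-3/2))\<close>, and the component \<open>d = 0\<close> or
  \<open>d = a-1\<close> attains this up to the error. Hence the row maximum is \<open>1 / sqrt (2 \<pi> (a-1) m)\<close> up to
  errors whose sum over all rows is bounded, and summing the main term over the rows gives
  \<open>2 sqrt n / sqrt ((a-1) \<pi>)\<close>.
\<close>

section \<open>Stirling's formula with an error bound\<close>

definition stirling_remainder :: "nat \<Rightarrow> real" where
  "stirling_remainder n =
     ln (fact n) - ((real n + 1/2) * ln (real n) - real n + ln (2 * pi) / 2)"

lemma stirling_remainder_diff_bounds: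
  assumes "n \<ge> 1"
  shows "stirling_remainder n - stirling_remainder (Suc n)
    \<in> {0..1 / (4 * real n) - 1 / (4 * real (Suc n))}"
proof -
  define x where "x = real n"
  have x: "x \<ge> 1" using assms by (simp add: x_def)
  have "ln (fact (Suc n)) = ln (x + 1) + ln (fact n :: real)"
    by (simp add: x_def ln_mult add_ac)
  hence diff: "stirling_remainder n - stirling_remainder (Suc n) =
      (x + 1/2) * (ln (x + 1) - ln x) - 1"
    by (simp add: stirling_remainder_def x_def algebra_simps)
  have "1 = (x + 1/2) * (2 * (x + 1 - x) / (x + (x + 1)))"
    using x by (simp add: field_simps)
  also have "\<dots> \<le> (x + 1/2) * (ln (x + 1) - ln x)"
    using x by (intro mult_left_mono ln_inverse_approx_ge) auto
  finally have lower: "0 \<le> stirling_remainder n - stirling_remainder (Suc n)"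
    by (simp add: diff)
  have "(x + 1/2) * (ln (x + 1) - ln x) \<le> (x + 1/2) * (1 * (inverse x + inverse (x + 1)) / 2)"
    using x by (intro mult_left_mono ln_inverse_approx_le) auto
  also have "\<dots> = 1 + (1 / (4 * x) - 1 / (4 * (x + 1)))"
    using x by (simp add: divide_simps) (simp add: algebra_simps)
  finally show ?thesis
    using lower by (simp add: diff x_def add_ac)
qed

lemma decseq_stirling_remainder: "decseq (\<lambda>n. stirling_remainder (Suc n))"
  using stirling_remainder_diff_bounds by (intro decseq_SucI) force

lemma incseq_stirling_remainder: "incseq (\<lambda>n. stirling_remainder (Suc n) - 1 / (4 * real (Suc n)))"
proof (rule incseq_SucI)
  fix n
  show "stirling_remainder (Suc n) - 1 / (4 * real (Suc n))
          \<le> stirling_remainder (Suc (Suc n)) - 1 / (4 * real (Suc (Suc n)))"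
    using stirling_remainder_diff_bounds[of "Suc n"] by simp
qed

lemma convergent_stirling_remainder: "convergent stirling_remainder"
proof -
  have "stirling_remainder 1 - 1/4 \<le> stirling_remainder (Suc n)" for n
    using incseqD[OF incseq_stirling_remainder, of 0 n] by (force intro: order_trans)
  then obtain c where "(\<lambda>n. stirling_remainder (Suc n)) \<longlonglongrightarrow> c"
    using decseq_convergent[OF decseq_stirling_remainder] by metis
  thus ?thesis
    by (auto intro: convergentI LIMSEQ_imp_Suc)
qed

lemma prod_wallis_eq:
  "(\<Prod>k=1..n. (4 * real k^2) / (4 * real k^2 - 1)) =
     (4^n * (fact n)^2 / fact (2 * n))^2 / (2 * real n + 1)"
proof (induction n)
  case (Suc n)
  define A where "A = 4^n * (fact n)^2 / (fact (2 * n) :: real)"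
  have factor: "4 * (real (Suc n))^2 - 1 = (2 * real n + 1) * (2 * real n + 3)"
    by (simp add: power2_eq_square algebra_simps)
  have "4 ^ Suc n * (fact (Suc n))^2 / (fact (2 * Suc n) :: real) =
      A * (2 * (real n + 1) / (2 * real n + 1))"
    by (simp add: A_def divide_simps) (simp add: algebra_simps power2_eq_square)
  moreover have "A\<^sup>2 / (2 * real n + 1)
      * (4 * (real n + 1)\<^sup>2 / ((2 * real n + 1) * (2 * real n + 3)))
      = (A * (2 * (real n + 1) / (2 * real n + 1)))\<^sup>2 / (2 * real n + 3)"
    by (simp add: power2_eq_square field_simps)
  ultimately show ?case
    by (simp only: prod.cl_ivl_Suc Suc.IH A_def [symmetric] factor) (simp add: add_ac)
qed auto

lemma exp_stirling_remainder_eq_wallis: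
  assumes "n > 0"
  shows "exp (2 * (2 * stirling_remainder n - stirling_remainder (2 * n))) =
    (\<Prod>k=1..n. (4 * real k^2) / (4 * real k^2 - 1)) * ((2 * real n + 1) / real n / pi)"
proof -
  have "2 * stirling_remainder n - stirling_remainder (2 * n) =
      2 * ln (fact n) - ln (fact (2 * n)) + 2 * real n * ln 2 - ln pi / 2 - ln (real n) / 2"
    using assms by (simp add: stirling_remainder_def ln_mult algebra_simps)
  hence "2 * (2 * stirling_remainder n - stirling_remainder (2 * n)) =
      ln ((4^n * (fact n)^2 / fact (2 * n))^2 / (pi * real n))"
    using assms ln_realpow[of 2 2] by (simp add: ln_mult ln_div ln_realpow)
  thus ?thesis
    unfolding prod_wallis_eq using assms by (simp add: divide_simps)
qed

lemma LIMSEQ_stirling_remainder: "stirling_remainder \<longlonglongrightarrow> 0"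
proof -
  obtain c where c: "stirling_remainder \<longlonglongrightarrow> c"
    using convergent_stirling_remainder by (auto simp: convergent_def)
  have "filterlim (\<lambda>n::nat. 2 * n) at_top at_top"
    by real_asymp
  hence "(\<lambda>n. stirling_remainder (2 * n)) \<longlonglongrightarrow> c"
    using c by (rule filterlim_compose[rotated])
  hence "(\<lambda>n. exp (2 * (2 * stirling_remainder n - stirling_remainder (2 * n))))
      \<longlonglongrightarrow> exp (2 * (2 * c - c))"
    by (intro tendsto_intros c)
  moreover have "(\<lambda>n. exp (2 * (2 * stirling_remainder n - stirling_remainder (2 * n))))
      \<longlonglongrightarrow> pi / 2 * (2 / pi)"
  proof (rule Lim_transform_eventually)
    show "(\<lambda>n. (\<Prod>k=1..n. (4 * real k^2) / (4 * real k^2 - 1)) * ((2 * real n + 1) / real n / pi))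
        \<longlonglongrightarrow> pi / 2 * (2 / pi)"
      by (intro tendsto_mult wallis tendsto_divide tendsto_const) (real_asymp, simp)
  qed (rule eventually_mono[OF eventually_gt_at_top[of 0]
        exp_stirling_remainder_eq_wallis [symmetric]])
  ultimately have "exp (2 * (2 * c - c)) = pi / 2 * (2 / pi)"
    by (rule LIMSEQ_unique)
  with c show ?thesis by simp
qed

lemma stirling_remainder_bounds:
  assumes "n \<ge> 1"
  shows "stirling_remainder n \<in> {0..1 / (4 * real n)}"
proof -
  obtain m where n: "n = Suc m" using assms by (cases n) auto
  have lim: "(\<lambda>n. stirling_remainder (Suc n)) \<longlonglongrightarrow> 0"
    using LIMSEQ_stirling_remainder by (rule LIMSEQ_Suc)
  moreover have "(\<lambda>n. 1 / (4 * real (Suc n))) \<longlonglongrightarrow> 0"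
    by real_asymp
  ultimately have "(\<lambda>n. stirling_remainder (Suc n) - 1 / (4 * real (Suc n))) \<longlonglongrightarrow> 0 - 0"
    by (rule tendsto_diff)
  hence "stirling_remainder (Suc m) - 1 / (4 * real (Suc m)) \<le> 0"
    using incseq_le[OF incseq_stirling_remainder, of 0] by simp
  moreover have "0 \<le> stirling_remainder (Suc m)"
    by (rule decseq_ge[OF decseq_stirling_remainder lim])
  ultimately show ?thesis by (simp add: n)
qed

section \<open>The largest point mass of a binomial distribution\<close>

definition binomial_peak :: "nat \<Rightarrow> real \<Rightarrow> real" where
  "binomial_peak N p = Max (pmf (binomial_pmf N p) ` {..N})"

definition gaussian_peak :: "real \<Rightarrow> real" where
  "gaussian_peak v = 1 / sqrt (2 * pi * v)"

lemma pmf_binomial_le_peak: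
  assumes "0 \<le> p" "p \<le> 1"
  shows "pmf (binomial_pmf N p) j \<le> binomial_peak N p"
proof (cases "j \<le> N")
  case True
  thus ?thesis unfolding binomial_peak_def by (intro Max_ge) auto
next
  case False
  hence "pmf (binomial_pmf N p) j = 0" using assms by simp
  also have "\<dots> \<le> pmf (binomial_pmf N p) 0" by simp
  also have "\<dots> \<le> binomial_peak N p" unfolding binomial_peak_def by (intro Max_ge) auto
  finally show ?thesis .
qed

lemma binomial_peak_attained: "\<exists>j\<le>N. binomial_peak N p = pmf (binomial_pmf N p) j"
  using Max_in[of "pmf (binomial_pmf N p) ` {..N}"] unfolding binomial_peak_def by fast

lemma binomial_peak_bounds: "binomial_peak N p \<in> {0..1}"
  using binomial_peak_attained[of N p] by (auto simp: pmf_le_1)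

lemma pmf_binomial_Suc:
  assumes "0 \<le> p" "p \<le> 1" "j < N"
  shows "real (Suc j) * (1 - p) * pmf (binomial_pmf N p) (Suc j) =
    real (N - j) * p * pmf (binomial_pmf N p) j"
proof -
  have "Suc j * (N choose Suc j) = (N - j) * (N choose j)"
    by (metis binomial_absorption binomial_absorb_comp)
  hence "real (Suc j) * real (N choose Suc j) = real (N - j) * real (N choose j)"
    by (metis of_nat_mult)
  moreover have "N - j = Suc (N - Suc j)" using assms by simp
  ultimately show ?thesis
    using assms by (simp add: mult_ac del: of_nat_Suc)
qed

lemma binomial_mode_near_mean:
  assumes p: "0 < p" "p < 1" and j: "j \<le> N"
    and mode: "\<And>i. pmf (binomial_pmf N p) i \<le> pmf (binomial_pmf N p) j"
  shows "\<bar>real j - real N * p\<bar> \<le> 1"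
proof -
  have pos: "0 < pmf (binomial_pmf N p) j" using p j by simp
  have "real N * p - 1 \<le> real j"
  proof (cases "j < N")
    case True
    have "real (N - j) * p * pmf (binomial_pmf N p) j =
        real (Suc j) * (1 - p) * pmf (binomial_pmf N p) (Suc j)"
      using p True by (intro pmf_binomial_Suc [symmetric]) auto
    also have "\<dots> \<le> real (Suc j) * (1 - p) * pmf (binomial_pmf N p) j"
      using p by (intro mult_left_mono mode) auto
    finally have "real (N - j) * p \<le> real (Suc j) * (1 - p)"
      using pos by (rule mult_right_le_imp_le)
    thus ?thesis using p j by (simp add: of_nat_diff algebra_simps)
  next
    case False
    moreover have "real N * p \<le> real N * 1" using p by (intro mult_left_mono) auto
    ultimately show ?thesis using j by simp
  qed
  moreover have "real j \<le> real N * p + 1"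
  proof (cases j)
    case 0
    thus ?thesis using p by simp
  next
    case (Suc i)
    have "real j * (1 - p) * pmf (binomial_pmf N p) j = real (N - i) * p * pmf (binomial_pmf N p) i"
      unfolding Suc using p j Suc by (intro pmf_binomial_Suc) auto
    also have "\<dots> \<le> real (N - i) * p * pmf (binomial_pmf N p) j"
      using p by (intro mult_left_mono mode) auto
    finally have "real j * (1 - p) \<le> real (N - i) * p"
      using pos by (rule mult_right_le_imp_le)
    thus ?thesis using p j Suc by (simp add: of_nat_diff algebra_simps)
  qed
  ultimately show ?thesis by (simp add: abs_le_iff)
qed

lemma ln_pmf_binomial_eq:
  assumes p: "0 < p" "p < 1" and j: "0 < j" "j < N"
  shows "ln (pmf (binomial_pmf N p) j) + ln (2 * pi * (real N * p * (1 - p))) / 2 =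
    stirling_remainder N - stirling_remainder j - stirling_remainder (N - j)
    - (real j + 1/2) * ln (real j / (real N * p))
    - (real (N - j) + 1/2) * ln (real (N - j) / (real N * (1 - p)))"
proof -
  define x y where "x = real j" and "y = real (N - j)"
  have xy: "x > 0" "y > 0" "real N = x + y"
    using j by (auto simp: x_def y_def)
  have "real (N choose j) = fact N / (fact j * fact (N - j))"
    using j by (simp add: binomial_fact)
  hence ln_pmf: "ln (pmf (binomial_pmf N p) j) =
      ln (fact N) - ln (fact j) - ln (fact (N - j)) + x * ln p + y * ln (1 - p)"
    using p j by (simp add: ln_mult ln_div ln_realpow x_def y_def)
  have ln_factors: "ln (2 * pi * (real N * p * (1 - p))) =
      ln (2 * pi) + ln (real N) + ln p + ln (1 - p)"
    "ln (x / (real N * p)) = ln x - ln (real N) - ln p"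
    "ln (y / (real N * (1 - p))) = ln y - ln (real N) - ln (1 - p)"
    using p xy(1,2) j by (simp_all add: ln_mult ln_div)
  show ?thesis
    unfolding ln_pmf stirling_remainder_def x_def [symmetric] y_def [symmetric] ln_factors
    by (simp add: xy(3) field_simps)
qed

lemma abs_add_half_mult_ln_ratio_le:
  fixes x u :: real
  assumes "2 \<le> u" "\<bar>x - u\<bar> \<le> 1"
  shows "\<bar>(x + 1/2) * ln (x / u) - (x - u)\<bar> \<le> 3 / (2 * u)"
proof -
  have x: "x \<ge> u / 2" "x > 0" using assms by (auto simp: abs_le_iff)
  have square_bound: "(x - u)\<^sup>2 + (x - u) / 2 \<le> 1 + 1 / 2"
    using assms by (intro add_mono) (auto simp: abs_square_le_1)
  have "(x + 1/2) * ln (x / u) \<le> (x + 1/2) * (x / u - 1)"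
    using assms x by (intro mult_left_mono ln_le_minus_one) auto
  also have "\<dots> = (x - u) + ((x - u)\<^sup>2 + (x - u) / 2) / u"
    using assms by (simp add: field_simps power2_eq_square)
  also have "\<dots> \<le> (x - u) + (3/2) / u"
    using assms square_bound by (intro add_left_mono divide_right_mono) auto
  finally have upper: "(x + 1/2) * ln (x / u) - (x - u) \<le> 3 / (2 * u)" by simp
  have "(x - u) - 3 / (2 * u) \<le> (x - u) - 1 / (2 * x)"
    using assms x by (auto simp: field_simps)
  also have "\<dots> \<le> (x - u) + (x - u) / (2 * x)"
    using assms x divide_right_mono[of "-1" "x - u" "2 * x"] by (simp add: abs_le_iff)
  also have "\<dots> = (x + 1/2) * (1 - u / x)"
    using x by (simp add: field_simps)
  also have "\<dots> \<le> (x + 1/2) * ln (x / u)"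
    using assms x ln_le_minus_one[of "u / x"] by (intro mult_left_mono) (auto simp: ln_div)
  finally show ?thesis using upper by (simp add: abs_le_iff)
qed

lemma abs_stirling_remainder_binomial_le:
  assumes "0 < j" "j < N"
  shows "\<bar>stirling_remainder N - stirling_remainder j - stirling_remainder (N - j)\<bar>
    \<le> 1 / (4 * real j) + 1 / (4 * real (N - j))"
proof -
  define k where "k = N - j"
  have "stirling_remainder i \<in> {0..1 / (4 * real i)}" if "0 < i" for i
    using that by (intro stirling_remainder_bounds) simp
  from this[of N] this[of j] this[of k]
  have "0 \<le> stirling_remainder N" "stirling_remainder N \<le> 1 / (4 * real N)"
    "0 \<le> stirling_remainder j" "stirling_remainder j \<le> 1 / (4 * real j)"
    "0 \<le> stirling_remainder k" "stirling_remainder k \<le> 1 / (4 * real k)"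
    using assms by (auto simp: k_def)
  moreover have "1 / (4 * real N) \<le> 1 / (4 * real j)"
    using assms by (intro divide_left_mono) auto
  moreover have "0 \<le> 1 / (4 * real k)" by simp
  ultimately show ?thesis
    unfolding k_def [symmetric] by linarith
qed

lemma ln_pmf_binomial_near_mean:
  assumes p: "0 < p" "p < 1" and var: "2 \<le> real N * p * (1 - p)" and j: "\<bar>real j - real N * p\<bar> \<le> 1"
  shows "\<bar>ln (pmf (binomial_pmf N p) j) + ln (2 * pi * (real N * p * (1 - p))) / 2\<bar>
    \<le> 2 / (real N * p * (1 - p))"
proof -
  define u w where "u = real N * p" and "w = real N * (1 - p)"
  have N: "real N > 0" using var by (auto intro: gr0I)
  have "u * (1 - p) \<le> u * 1" "w * p \<le> w * 1"
    unfolding u_def w_def using p by (intro mult_left_mono; simp)+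
  hence uw_ge: "2 \<le> u" "2 \<le> w"
    using var by (auto simp: u_def w_def mult_ac)
  have uw_sum: "u + w = real N" by (simp add: u_def w_def algebra_simps)
  have "real j < real N" using uw_ge uw_sum j by (simp add: u_def abs_le_iff)
  hence j_bounds: "0 < j" "j < N" using uw_ge j by (auto simp: u_def abs_le_iff intro: gr0I)
  define k where "k = N - j"
  have jk_sum: "real j + real k = real N" using j_bounds by (simp add: k_def)
  have j_near: "\<bar>real j - u\<bar> \<le> 1" and k_near: "\<bar>real k - w\<bar> \<le> 1"
    using j jk_sum uw_sum by (auto simp: u_def)
  have "\<bar>stirling_remainder N - stirling_remainder j - stirling_remainder k\<bar>
      \<le> 1 / (4 * real j) + 1 / (4 * real k)"
    unfolding k_def by (rule abs_stirling_remainder_binomial_le[OF j_bounds])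
  also have "\<dots> \<le> 1 / (2 * u) + 1 / (2 * w)"
    using uw_ge j_near k_near
    by (intro add_mono divide_left_mono) (auto simp: abs_le_iff)
  finally have "\<bar>stirling_remainder N - stirling_remainder j - stirling_remainder k\<bar>
      \<le> 1 / (2 * u) + 1 / (2 * w)" .
  moreover have "\<bar>(real j + 1/2) * ln (real j / u) - (real j - u)\<bar> \<le> 3 / (2 * u)"
    "\<bar>(real k + 1/2) * ln (real k / w) - (real k - w)\<bar> \<le> 3 / (2 * w)"
    by (intro abs_add_half_mult_ln_ratio_le uw_ge j_near k_near)+
  ultimately have "\<bar>ln (pmf (binomial_pmf N p) j) + ln (2 * pi * (real N * p * (1 - p))) / 2\<bar>
      \<le> (1 / (2 * u) + 1 / (2 * w)) + 3 / (2 * u) + 3 / (2 * w)"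
    unfolding ln_pmf_binomial_eq[OF p j_bounds]
    unfolding k_def [symmetric] u_def [symmetric] w_def [symmetric]
    using jk_sum uw_sum by linarith
  also have "\<dots> = 2 * (u + w) / (u * w)"
    using uw_ge by (simp add: divide_simps)
  also have "\<dots> = 2 / (real N * p * (1 - p))"
    using N by (simp add: uw_sum) (simp add: u_def w_def)
  finally show ?thesis .
qed

lemma abs_exp_minus_one_le:
  fixes x :: real
  assumes "\<bar>x\<bar> \<le> 1"
  shows "\<bar>exp x - 1\<bar> \<le> 2 * \<bar>x\<bar>"
proof -
  have "exp x \<le> exp \<bar>x\<bar>" by simp
  also have "\<dots> \<le> 1 + \<bar>x\<bar> + \<bar>x\<bar>\<^sup>2"
    using assms by (intro exp_bound) auto
  also have "\<bar>x\<bar>\<^sup>2 \<le> \<bar>x\<bar>"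
    using assms by (auto simp: power2_eq_square simp del: abs_mult_self_eq intro!: mult_left_le)
  finally show ?thesis
    using exp_ge_add_one_self[of x] by linarith
qed

lemma pmf_binomial_near_mean:
  assumes p: "0 < p" "p < 1" and var: "2 \<le> real N * p * (1 - p)" and j: "\<bar>real j - real N * p\<bar> \<le> 1"
  shows "\<bar>pmf (binomial_pmf N p) j - gaussian_peak (real N * p * (1 - p))\<bar>
    \<le> 4 * (real N * p * (1 - p)) powr (-3/2)"
proof -
  define v where "v = real N * p * (1 - p)"
  define e where "e = ln (pmf (binomial_pmf N p) j) + ln (2 * pi * v) / 2"
  have v: "2 \<le> v" using var by (simp add: v_def)
  have "real j \<le> real N"
  proof -
    have "v \<le> real N * (1 - p) * 1"
      unfolding v_def using p by (simp add: mult.assoc mult_left_mono)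
    hence "real N * p + 2 \<le> real N" using v by (simp add: algebra_simps)
    thus ?thesis using j by (simp add: abs_le_iff)
  qed
  hence pos: "0 < pmf (binomial_pmf N p) j" using p by simp
  have e: "\<bar>e\<bar> \<le> 2 / v"
    using ln_pmf_binomial_near_mean[OF p var j] by (simp only: e_def v_def)
  have "2 / v \<le> 1" using v by simp
  hence "\<bar>exp e - 1\<bar> \<le> 2 * (2 / v)"
    using abs_exp_minus_one_le[of e] e by linarith
  have "pmf (binomial_pmf N p) j = exp e / sqrt (2 * pi * v)"
    using pos v by (simp add: e_def exp_add flip: ln_sqrt)
  hence "\<bar>pmf (binomial_pmf N p) j - gaussian_peak v\<bar> = \<bar>exp e - 1\<bar> / sqrt (2 * pi * v)"
    using v by (simp add: gaussian_peak_def abs_divide flip: diff_divide_distrib)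
  also have "\<dots> \<le> (4 / v) / sqrt v"
    using \<open>\<bar>exp e - 1\<bar> \<le> 2 * (2 / v)\<close> v pi_ge_two by (intro frac_le) auto
  also have "\<dots> = 4 * v powr (-3/2)"
    using v powr_mult_base[of v "1/2"] by (simp add: powr_minus_divide powr_half_sqrt)
  finally show ?thesis by (simp only: v_def)
qed

lemma binomial_peak_approx_large_variance:
  assumes p: "0 < p" "p < 1" and var: "2 \<le> real N * p * (1 - p)"
  shows "\<bar>binomial_peak N p - gaussian_peak (real N * p * (1 - p))\<bar>
    \<le> 4 * (real N * p * (1 - p)) powr (-3/2)"
proof -
  obtain j where j: "j \<le> N" "binomial_peak N p = pmf (binomial_pmf N p) j"
    using binomial_peak_attained by blast
  have "\<bar>real j - real N * p\<bar> \<le> 1"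
    using p j pmf_binomial_le_peak[of p N] by (intro binomial_mode_near_mean) auto
  thus ?thesis
    unfolding j(2) by (intro pmf_binomial_near_mean p var)
qed

lemma binomial_variance_Suc_le:
  assumes "0 \<le> p" "p \<le> 1" "N \<noteq> 0"
  shows "(real N + 1) * p * (1 - p) \<le> 2 * (real N * p * (1 - p))"
proof -
  have "(real N + 1) * (p * (1 - p)) \<le> 2 * real N * (p * (1 - p))"
    using assms by (intro mult_right_mono) auto
  thus ?thesis by (simp add: mult.assoc)
qed

lemma binomial_peak_approx_small_variance:
  assumes p: "0 < p" "p < 1" and var: "(real N + 1) * p * (1 - p) \<le> 4"
  shows "\<bar>binomial_peak N p - gaussian_peak (real N * p * (1 - p))\<bar>
    \<le> ((real N + 1) * p * (1 - p) / 4) powr (-3/2)"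
proof -
  define v t where "v = real N * p * (1 - p)" and "t = (real N + 1) * p * (1 - p) / 4"
  have v: "0 \<le> v" and t: "0 < t" "t \<le> 1" using p var by (simp_all add: v_def t_def add_nonneg_pos)
  have "gaussian_peak v \<le> t powr (-1/2)"
  proof (cases "N = 0")
    case False
    hence "4 * t \<le> 2 * v"
      using binomial_variance_Suc_le[of p N] p by (simp add: v_def t_def)
    hence "t \<le> 1 * v" using t by simp
    also have "\<dots> \<le> (2 * pi) * v"
      using v pi_ge_two by (intro mult_right_mono) auto
    finally have "gaussian_peak v \<le> 1 / sqrt t"
      unfolding gaussian_peak_def using t by (intro divide_left_mono) (auto intro: less_le_trans)
    thus ?thesis using t by (simp add: powr_minus_divide powr_half_sqrt)
  qed (simp add: v_def gaussian_peak_def)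
  also have "\<dots> \<le> t powr (-3/2)"
    using t by (intro powr_mono') auto
  finally have "gaussian_peak v \<le> t powr (-3/2)" .
  moreover have "1 \<le> t powr (-3/2)"
    using t powr_mono'[of "-3/2" 0 t] by simp
  moreover have "0 \<le> gaussian_peak v" using v by (simp add: gaussian_peak_def)
  moreover have "0 \<le> binomial_peak N p" "binomial_peak N p \<le> 1"
    using binomial_peak_bounds[of N p] by auto
  ultimately have "\<bar>binomial_peak N p - gaussian_peak v\<bar> \<le> t powr (-3/2)" by linarith
  thus ?thesis by (simp only: v_def t_def)
qed

text \<open>
  \<open>gaussian_peak 0\<close> is 0, as a division by zero; the factor \<open>N + 1\<close> instead of \<open>N\<close> in the error
  makes the bound hold for \<open>N = 0\<close>, too.
\<close>

lemma binomial_peak_approx: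
  assumes p: "0 < p" "p < 1"
  shows "\<bar>binomial_peak N p - gaussian_peak (real N * p * (1 - p))\<bar>
    \<le> 32 * ((real N + 1) * p * (1 - p)) powr (-3/2)"
proof -
  define v w where "v = real N * p * (1 - p)" and "w = (real N + 1) * p * (1 - p)"
  have w: "0 < w" using p by (simp add: w_def add_nonneg_pos)
  have "\<bar>binomial_peak N p - gaussian_peak v\<bar> \<le> 4 * (w / 4) powr (-3/2)"
  proof (cases "w \<le> 4")
    case True
    hence "\<bar>binomial_peak N p - gaussian_peak v\<bar> \<le> 1 * (w / 4) powr (-3/2)"
      using binomial_peak_approx_small_variance[OF p, of N] by (simp add: v_def w_def)
    also have "\<dots> \<le> 4 * (w / 4) powr (-3/2)" by (intro mult_right_mono) auto
    finally show ?thesis .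
  next
    case False
    have "p * (1 - p) \<le> 1 * 1" using p by (intro mult_mono) auto
    hence "N \<noteq> 0" using False by (intro notI) (simp add: w_def)
    hence vw: "w \<le> 2 * v"
      using binomial_variance_Suc_le[of p N] p by (simp add: v_def w_def)
    have "\<bar>binomial_peak N p - gaussian_peak v\<bar> \<le> 4 * v powr (-3/2)"
      unfolding v_def using False vw p
      by (intro binomial_peak_approx_large_variance) (auto simp: v_def)
    also have "\<dots> \<le> 4 * (w / 4) powr (-3/2)"
      using w vw by (intro mult_left_mono powr_mono2') auto
    finally show ?thesis .
  qed
  also have "(w / 4) powr (-3/2) = 8 * w powr (-3/2)"
    using powr_powr[of 2 2 "-3/2"] w by (simp add: powr_divide powr_minus_divide)
  finally show ?thesis by (simp add: v_def w_def)
qed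

section \<open>Probability generating functions as polynomials\<close>

definition is_pgf :: "real poly \<Rightarrow> bool" where
  "is_pgf f \<longleftrightarrow> (\<forall>i. 0 \<le> coeff f i) \<and> poly f 1 = 1"

definition pgf_mean :: "real poly \<Rightarrow> real" where
  "pgf_mean f = poly (pderiv f) 1"

definition pgf_variance :: "real poly \<Rightarrow> real" where
  "pgf_variance f = poly (pderiv (pderiv f)) 1 + pgf_mean f - (pgf_mean f)\<^sup>2"

lemma is_pgf_mult: "is_pgf f \<Longrightarrow> is_pgf g \<Longrightarrow> is_pgf (f * g)"
  by (simp add: is_pgf_def coeff_mult sum_nonneg)

lemma is_pgf_power: "is_pgf f \<Longrightarrow> is_pgf (f ^ n)"
  by (induction n) (simp_all add: is_pgf_mult, simp add: is_pgf_def coeff_1)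

lemma pgf_mean_mult: "is_pgf f \<Longrightarrow> is_pgf g \<Longrightarrow> pgf_mean (f * g) = pgf_mean f + pgf_mean g"
  by (simp add: is_pgf_def pgf_mean_def pderiv_mult)

lemma pgf_variance_mult:
  "is_pgf f \<Longrightarrow> is_pgf g \<Longrightarrow> pgf_variance (f * g) = pgf_variance f + pgf_variance g"
  by (simp add: is_pgf_def pgf_variance_def pgf_mean_def
      pderiv_mult pderiv_add power2_eq_square algebra_simps)

lemma pgf_mean_power: "is_pgf f \<Longrightarrow> pgf_mean (f ^ n) = real n * pgf_mean f"
  by (induction n) (simp_all add: pgf_mean_mult is_pgf_power algebra_simps, simp add: pgf_mean_def)

lemma pgf_variance_power: "is_pgf f \<Longrightarrow> pgf_variance (f ^ n) = real n * pgf_variance f"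
  by (induction n)
    (simp_all add: pgf_variance_mult is_pgf_power algebra_simps,
      simp add: pgf_variance_def pgf_mean_def)

lemma sum_coeff_eq_poly_1:
  fixes f :: "'a :: comm_semiring_1 poly"
  assumes "degree f \<le> n"
  shows "(\<Sum>i\<le>n. coeff f i) = poly f 1"
  using assms by (simp add: poly_altdef coeff_eq_0 sum.mono_neutral_left[of "{..n}" "{..degree f}"])

lemma coeff_pCons_0_pderiv:
  fixes f :: "'a :: {comm_semiring_1, semiring_no_zero_divisors} poly"
  shows "coeff (pCons 0 (pderiv f)) i = of_nat i * coeff f i"
  by (cases i) (simp_all add: coeff_pderiv)

lemma degree_pCons_0_pderiv_le:
  fixes f :: "'a :: {comm_semiring_1, semiring_no_zero_divisors} poly"
  shows "degree (pCons 0 (pderiv f)) \<le> degree f"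
  by (intro degree_le allI impI) (simp only: coeff_pCons_0_pderiv, simp add: coeff_eq_0)

lemma sum_index_mult_coeff:
  fixes f :: "'a :: {comm_semiring_1, semiring_no_zero_divisors} poly"
  assumes "degree f \<le> n"
  shows "(\<Sum>i\<le>n. of_nat i * coeff f i) = poly (pderiv f) 1"
  using sum_coeff_eq_poly_1[OF order_trans[OF degree_pCons_0_pderiv_le assms]]
  by (simp only: coeff_pCons_0_pderiv) simp

lemma sum_index_square_mult_coeff:
  fixes f :: "'a :: {comm_semiring_1, semiring_no_zero_divisors} poly"
  assumes "degree f \<le> n"
  shows "(\<Sum>i\<le>n. of_nat i ^ 2 * coeff f i) = poly (pderiv (pderiv f)) 1 + poly (pderiv f) 1"
  using sum_index_mult_coeff[OF order_trans[OF degree_pCons_0_pderiv_le assms]]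
  by (simp only: coeff_pCons_0_pderiv)
    (simp add: pderiv_pCons power2_eq_square mult.assoc add.commute)

lemma pgf_variance_eq_sum:
  assumes "is_pgf f" "degree f \<le> n"
  shows "pgf_variance f = (\<Sum>i\<le>n. coeff f i * (real i - pgf_mean f)\<^sup>2)"
proof -
  define m where "m = pgf_mean f"
  have "(\<Sum>i\<le>n. coeff f i * (real i - m)\<^sup>2) =
      (\<Sum>i\<le>n. real i ^ 2 * coeff f i) - 2 * m * (\<Sum>i\<le>n. real i * coeff f i) + m\<^sup>2 * (\<Sum>i\<le>n. coeff f i)"
    unfolding sum_distrib_left sum_subtractf [symmetric] sum.distrib [symmetric]
    by (intro sum.cong refl) (simp add: power2_eq_square algebra_simps)
  also have "\<dots> = (poly (pderiv (pderiv f)) 1 + m) - 2 * m * m + m\<^sup>2 * 1"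
    using assms
    by (simp only: sum_coeff_eq_poly_1 sum_index_mult_coeff sum_index_square_mult_coeff
        is_pgf_def pgf_mean_def m_def)
  finally show ?thesis by (simp add: pgf_variance_def m_def power2_eq_square)
qed

lemma coeff_pgf_chebyshev:
  assumes f: "is_pgf f" and t: "0 < t" "t \<le> \<bar>real i - pgf_mean f\<bar>"
  shows "coeff f i \<le> pgf_variance f / t\<^sup>2"
proof -
  have nonneg: "0 \<le> coeff f j" for j using f by (simp add: is_pgf_def)
  have "coeff f i * t\<^sup>2 \<le> coeff f i * (real i - pgf_mean f)\<^sup>2"
    using t by (intro mult_left_mono nonneg) (simp add: abs_le_square_iff [symmetric])
  also have "\<dots> \<le> (\<Sum>j\<le>max i (degree f). coeff f j * (real j - pgf_mean f)\<^sup>2)"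
    using nonneg by (intro member_le_sum) auto
  also have "\<dots> = pgf_variance f"
    using f by (intro pgf_variance_eq_sum [symmetric]) auto
  finally show ?thesis using t by (simp add: pos_le_divide_eq)
qed

lemma coeff_mult_pgf_le:
  assumes f: "\<And>i. coeff f i \<le> M" and g: "is_pgf g"
  shows "coeff (f * g) i \<le> M"
proof -
  have nonneg: "0 \<le> coeff g j" for j using g by (simp add: is_pgf_def)
  have "0 \<le> M" using f[of "Suc (degree f)"] by (simp add: coeff_eq_0)
  have "coeff (f * g) i = (\<Sum>j\<le>i. coeff f (i - j) * coeff g j)"
    using coeff_mult[of g f i] by (simp add: mult.commute)
  also have "\<dots> \<le> (\<Sum>j\<le>i. M * coeff g j)"
    using f nonneg by (intro sum_mono mult_right_mono)
  also have "\<dots> \<le> (\<Sum>j\<le>max i (degree g). M * coeff g j)"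
    using \<open>0 \<le> M\<close> nonneg by (intro sum_mono2) auto
  also have "\<dots> = M"
    using g by (simp add: sum_coeff_eq_poly_1 is_pgf_def flip: sum_distrib_left)
  finally show ?thesis .
qed

definition bernoulli_pgf :: "real \<Rightarrow> real poly" where
  "bernoulli_pgf p = [:1 - p, p:]"

lemma poly_bernoulli_pgf: "poly (bernoulli_pgf p) x = 1 + p * (x - 1)"
  by (simp add: bernoulli_pgf_def algebra_simps)

lemma is_pgf_bernoulli: "0 \<le> p \<Longrightarrow> p \<le> 1 \<Longrightarrow> is_pgf (bernoulli_pgf p)"
  by (simp add: is_pgf_def bernoulli_pgf_def coeff_pCons split: nat.split)

lemma pgf_mean_bernoulli: "pgf_mean (bernoulli_pgf p) = p"
  by (simp add: pgf_mean_def bernoulli_pgf_def pderiv_pCons)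

lemma pgf_variance_bernoulli: "pgf_variance (bernoulli_pgf p) = p * (1 - p)"
  unfolding pgf_variance_def pgf_mean_bernoulli
  by (simp add: bernoulli_pgf_def pderiv_pCons power2_eq_square algebra_simps)

lemma coeff_bernoulli_pgf_power:
  assumes "0 \<le> p" "p \<le> 1"
  shows "coeff (bernoulli_pgf p ^ N) j = pmf (binomial_pmf N p) j"
proof (cases "j \<le> N")
  case True
  thus ?thesis using assms by (simp add: bernoulli_pgf_def coeff_linear_poly_power)
next
  case False
  have "degree (bernoulli_pgf p ^ N) \<le> degree (bernoulli_pgf p) * N" by (rule degree_power_le)
  also have "\<dots> \<le> 1 * N" by (intro mult_right_mono) (auto simp: bernoulli_pgf_def)
  finally have "coeff (bernoulli_pgf p ^ N) j = 0" using False by (intro coeff_eq_0) simp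
  thus ?thesis using False assms by simp
qed

section \<open>Rows of the powers of the riffle matrix\<close>

text \<open>
  In an inverse \<open>a\<close>-shuffle every position receives an independent uniform digit below \<open>a\<close>.
  For a position with \<open>r\<close> positions before it, \<open>s\<close> behind it, and digit \<open>d\<close>, the number of cards
  that end up in front of its card counts the earlier positions with digit \<open>\<le> d\<close> and the later
  ones with digit \<open>< d\<close>.
\<close>

definition digit_pgf :: "nat \<Rightarrow> nat \<Rightarrow> nat \<Rightarrow> nat \<Rightarrow> real poly" where
  "digit_pgf a d r s =
      bernoulli_pgf (real (Suc d) / real a) ^ r * bernoulli_pgf (real d / real a) ^ s"

definition shuffle_pgf :: "nat \<Rightarrow> nat \<Rightarrow> nat \<Rightarrow> real poly" where
  "shuffle_pgf a r s = Polynomial.smult (1 / real a) (\<Sum>d<a. digit_pgf a d r s)"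

lemma coeff_shuffle_pgf:
  "coeff (shuffle_pgf a r s) c = (\<Sum>d<a. coeff (digit_pgf a d r s) c) / real a"
  by (simp add: shuffle_pgf_def coeff_sum)

lemma sum_choose_mult_powers:
  fixes u v :: "'a :: comm_semiring_1"
  assumes "r < n"
  shows "(\<Sum>j<n. of_nat (r choose j) * (u ^ j * v ^ (n - 1 - j))) = (u + v) ^ r * v ^ (n - 1 - r)"
proof -
  have "(\<Sum>j<n. of_nat (r choose j) * (u ^ j * v ^ (n - 1 - j))) =
      (\<Sum>j\<le>r. of_nat (r choose j) * (u ^ j * v ^ (n - 1 - j)))"
    using assms by (intro sum.mono_neutral_right ballI) (auto simp: binomial_eq_0)
  also have "\<dots> = (\<Sum>j\<le>r. of_nat (r choose j) * u ^ j * v ^ (r - j) * v ^ (n - 1 - r))"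
    using assms by (intro sum.cong refl) (simp add: mult.assoc flip: power_add)
  also have "\<dots> = (u + v) ^ r * v ^ (n - 1 - r)"
    by (simp add: binomial_ring sum_distrib_right)
  finally show ?thesis .
qed

lemma riffle_entry_Suc:
  assumes "r < n" "j < n"
  shows "riffle_entry (Suc r) (Suc j) n =
    real (r choose j) / 2 ^ Suc r + real ((n - 1 - r) choose (n - 1 - j)) / 2 ^ Suc (n - 1 - r)"
proof -
  have "real ((n - Suc r) choose (n - Suc j)) =
      (if r \<le> j then real ((n - Suc r) choose (j - r)) else 0)"
    using assms binomial_symmetric[of "j - r" "n - Suc r"] by auto
  thus ?thesis by (simp add: riffle_entry_def)
qed

lemma riffle_entry_generating_function:
  fixes u v :: real
  assumes "r < n"
  shows "(\<Sum>j<n. riffle_entry (Suc r) (Suc j) n * (u ^ j * v ^ (n - 1 - j))) =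
    (((u + v) / 2) ^ r * v ^ (n - 1 - r) + u ^ r * ((u + v) / 2) ^ (n - 1 - r)) / 2"
proof -
  define s where "s = n - 1 - r"
  have s: "s < n" "n - 1 - s = r" using assms by (auto simp: s_def)
  have "(\<Sum>j<n. real (s choose (n - 1 - j)) * (u ^ j * v ^ (n - 1 - j))) =
      (\<Sum>j<n. real (s choose j) * (v ^ j * u ^ (n - 1 - j)))"
    by (subst sum.nat_diff_reindex [symmetric]) (intro sum.cong refl, simp add: mult_ac)
  also have "\<dots> = (u + v) ^ s * u ^ r"
    using sum_choose_mult_powers[OF s(1), of v u] by (simp only: s(2) add.commute)
  finally have reflected: "(\<Sum>j<n. real (s choose (n - 1 - j)) * (u ^ j * v ^ (n - 1 - j))) =
      (u + v) ^ s * u ^ r" .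
  have "(\<Sum>j<n. riffle_entry (Suc r) (Suc j) n * (u ^ j * v ^ (n - 1 - j))) =
      (\<Sum>j<n. real (r choose j) * (u ^ j * v ^ (n - 1 - j))) / 2 ^ Suc r +
      (\<Sum>j<n. real (s choose (n - 1 - j)) * (u ^ j * v ^ (n - 1 - j))) / 2 ^ Suc s"
    unfolding sum_divide_distrib sum.distrib [symmetric]
    using assms by (intro sum.cong refl)
      (simp add: riffle_entry_Suc s_def add_divide_distrib distrib_right)
  also have "\<dots> = (u + v) ^ r * v ^ s / 2 ^ Suc r + (u + v) ^ s * u ^ r / 2 ^ Suc s"
    using reflected sum_choose_mult_powers[OF assms, of u v] by (simp only: s_def)
  finally show ?thesis
    unfolding s_def [symmetric] power_divide by (simp add: add_divide_distrib mult_ac)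
qed

text \<open>A further riffle shuffle refines the digit \<open>d\<close> to one of \<open>2 * d\<close> and \<open>2 * d + 1\<close>.\<close>

lemma digit_pgf_refine:
  assumes "a > 0" "r < n"
  shows "(\<Sum>j<n. Polynomial.smult (riffle_entry (Suc r) (Suc j) n) (digit_pgf a d j (n - 1 - j))) =
    Polynomial.smult (1/2)
      (digit_pgf (2 * a) (2 * d) r (n - 1 - r) + digit_pgf (2 * a) (Suc (2 * d)) r (n - 1 - r))"
    (is "?lhs = ?rhs")
proof -
  have "poly ?lhs x = poly ?rhs x" for x
  proof -
    define u v where "u = poly (bernoulli_pgf (real (Suc d) / real a)) x"
      and "v = poly (bernoulli_pgf (real d / real a)) x"
    have refined: "poly (bernoulli_pgf (real (2 * d) / real (2 * a))) x = v"
      "poly (bernoulli_pgf (real (Suc (2 * d)) / real (2 * a))) x = (u + v) / 2"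
      "poly (bernoulli_pgf (real (Suc (Suc (2 * d))) / real (2 * a))) x = u"
      using assms by (simp_all add: u_def v_def poly_bernoulli_pgf field_simps)
    have "poly ?lhs x = (\<Sum>j<n. riffle_entry (Suc r) (Suc j) n * (u ^ j * v ^ (n - 1 - j)))"
      by (simp only: poly_sum poly_smult digit_pgf_def poly_mult poly_power u_def v_def)
    also have "\<dots> = poly ?rhs x"
      unfolding riffle_entry_generating_function[OF assms(2)]
      by (simp only: poly_smult poly_add digit_pgf_def poly_mult poly_power refined)
    finally show ?thesis .
  qed
  thus ?thesis by (intro poly_eq_poly_eq_iff[THEN iffD1] ext)
qed

lemma sum_lessThan_double:
  fixes f :: "nat \<Rightarrow> 'a :: comm_monoid_add"
  shows "(\<Sum>d<2 * a. f d) = (\<Sum>d<a. f (2 * d) + f (Suc (2 * d)))"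
  by (induction a) (simp_all add: add_ac)

lemma coeff_shuffle_pgf_double:
  assumes "a > 0" "r < n"
  shows "(\<Sum>j<n. riffle_entry (Suc r) (Suc j) n * coeff (shuffle_pgf a j (n - 1 - j)) c) =
    coeff (shuffle_pgf (2 * a) r (n - 1 - r)) c"
proof -
  define g where "g b d j = coeff (digit_pgf b d j (n - 1 - j)) c" for b d j
  have digit_sum_refine: "(\<Sum>j<n. riffle_entry (Suc r) (Suc j) n * g a d j) =
      (g (2 * a) (2 * d) r + g (2 * a) (Suc (2 * d)) r) / 2" for d
    using arg_cong[OF digit_pgf_refine[OF assms, of d], of "\<lambda>f. coeff f c"]
    by (simp add: g_def coeff_sum)
  have "(\<Sum>j<n. riffle_entry (Suc r) (Suc j) n * coeff (shuffle_pgf a j (n - 1 - j)) c) =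
      (\<Sum>j<n. \<Sum>d<a. riffle_entry (Suc r) (Suc j) n * g a d j) / real a"
    by (simp add: coeff_shuffle_pgf g_def sum_distrib_left sum_divide_distrib)
  also have "(\<Sum>j<n. \<Sum>d<a. riffle_entry (Suc r) (Suc j) n * g a d j) =
      (\<Sum>d<a. \<Sum>j<n. riffle_entry (Suc r) (Suc j) n * g a d j)"
    by (rule sum.swap)
  also have "\<dots> = (\<Sum>d<2 * a. g (2 * a) d r) / 2"
    by (simp only: digit_sum_refine sum_lessThan_double sum_divide_distrib)
  also have "\<dots> / real a = coeff (shuffle_pgf (2 * a) r (n - 1 - r)) c"
    by (simp add: coeff_shuffle_pgf g_def)
  finally show ?thesis .
qed

lemma pow_mat_Suc_left:
  fixes A :: "'a :: semiring_1 mat"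
  assumes "A \<in> carrier_mat n n"
  shows "A ^\<^sub>m Suc k = A * A ^\<^sub>m k"
proof (induction k)
  case (Suc k)
  have "A ^\<^sub>m Suc (Suc k) = A * A ^\<^sub>m k * A" using Suc by simp
  also have "\<dots> = A * (A ^\<^sub>m k * A)"
    using assms by (intro assoc_mult_mat) auto
  finally show ?case by simp
qed (use assms in auto)

lemma riffle_mat_power_entry:
  assumes "r < n" "c < n"
  shows "(riffle_mat n ^\<^sub>m k) $$ (r, c) = coeff (shuffle_pgf (2 ^ k) r (n - 1 - r)) c"
  using assms(1)
proof (induction k arbitrary: r)
  case 0
  have "shuffle_pgf 1 r (n - 1 - r) = monom 1 r"
    by (simp add: shuffle_pgf_def digit_pgf_def bernoulli_pgf_def monom_altdef pCons_one)
  thus ?case using 0 assms by (simp add: riffle_mat_def)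
next
  case (Suc k)
  have carrier: "riffle_mat n \<in> carrier_mat n n" "riffle_mat n ^\<^sub>m k \<in> carrier_mat n n"
    by (simp_all add: riffle_mat_def pow_carrier_mat)
  have "(riffle_mat n ^\<^sub>m Suc k) $$ (r, c) =
      (\<Sum>j<n. riffle_mat n $$ (r, j) * (riffle_mat n ^\<^sub>m k) $$ (j, c))"
    unfolding pow_mat_Suc_left[OF carrier(1)]
    using Suc.prems assms carrier by (simp add: scalar_prod_def atLeast0LessThan)
  also have "\<dots> =
      (\<Sum>j<n. riffle_entry (Suc r) (Suc j) n * coeff (shuffle_pgf (2 ^ k) j (n - 1 - j)) c)"
    using Suc.prems by (intro sum.cong refl) (simp add: Suc.IH, simp add: riffle_mat_def)
  also have "\<dots> = coeff (shuffle_pgf (2 ^ Suc k) r (n - 1 - r)) c"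
    using coeff_shuffle_pgf_double[of "2 ^ k" r n c] Suc.prems by simp
  finally show ?case .
qed

lemma expected_score_eq_sum_Max:
  "expected_score k n = (\<Sum>r<n. Max (coeff (shuffle_pgf (2 ^ k) r (n - 1 - r)) ` {..<n}))"
proof -
  have "riffle_prob k n (Suc r) ` {1..n} =
      coeff (shuffle_pgf (2 ^ k) r (n - 1 - r)) ` {..<n}" if "r < n" for r
  proof -
    have "{1..n} = Suc ` {..<n}"
      by (simp add: lessThan_atLeast0 image_Suc_atLeastLessThan atLeastLessThanSuc_atLeastAtMost)
    thus ?thesis using that by (simp add: image_image riffle_prob_def riffle_mat_power_entry)
  qed
  moreover have "expected_score k n = (\<Sum>r<n. Max (riffle_prob k n (Suc r) ` {1..n}))"
    unfolding expected_score_def by (simp add: sum.atLeast1_atMost_eq)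
  ultimately show ?thesis by (auto intro!: sum.cong)
qed

section \<open>Estimates for the row maxima\<close>

definition digit_variance :: "nat \<Rightarrow> real" where
  "digit_variance a = (real a - 1) / (real a)\<^sup>2"

definition row_peak :: "nat \<Rightarrow> nat \<Rightarrow> real" where
  "row_peak a m = 1 / sqrt (2 * pi * (real a - 1) * real m)"

definition peak_error :: "nat \<Rightarrow> nat \<Rightarrow> real" where
  "peak_error a m = 32 * ((real m + 1) * digit_variance a) powr (-3/2)"

lemma row_peak_nonneg: "2 \<le> a \<Longrightarrow> 0 \<le> row_peak a m"
  by (simp add: row_peak_def)

lemma peak_error_nonneg: "0 \<le> peak_error a m"
  by (simp add: peak_error_def)

lemma row_peak_eq_gaussian_peak:
  assumes "2 \<le> a"
  shows "real a * row_peak a m = gaussian_peak (real m * digit_variance a)"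
proof -
  have "2 * pi * (real m * digit_variance a) = (2 * pi * (real a - 1) * real m) / (real a)\<^sup>2"
    by (simp add: digit_variance_def)
  also have "sqrt \<dots> = sqrt (2 * pi * (real a - 1) * real m) / real a"
    by (simp add: real_sqrt_divide)
  finally show ?thesis by (simp add: row_peak_def gaussian_peak_def)
qed

lemma binomial_peak_approx_row_peak:
  assumes "2 \<le> a" and p: "p * (1 - p) = digit_variance a"
  shows "\<bar>binomial_peak m p - real a * row_peak a m\<bar> \<le> peak_error a m"
proof -
  have "0 < p * (1 - p)" using assms by (simp add: digit_variance_def)
  hence "0 < p" "p < 1" by (auto simp: zero_less_mult_iff)
  thus ?thesis
    using binomial_peak_approx[of p m] assms
    by (simp add: row_peak_eq_gaussian_peak peak_error_def mult.assoc)
qed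

lemma digit_variance_le:
  assumes "1 \<le> d" "d < a"
  shows "digit_variance a \<le> real d / real a * (1 - real d / real a)"
proof -
  have "0 \<le> (real d - 1) * (real a - real d - 1)" using assms by (intro mult_nonneg_nonneg) auto
  hence "real a - 1 \<le> real d * (real a - real d)" by (simp add: algebra_simps)
  hence "(real a - 1) / (real a)\<^sup>2 \<le> real d * (real a - real d) / (real a)\<^sup>2"
    by (intro divide_right_mono) auto
  also have "\<dots> = real d / real a * (1 - real d / real a)"
    using assms by (simp add: field_simps power2_eq_square)
  finally show ?thesis by (simp only: digit_variance_def)
qed

lemma binomial_peak_le_row_peak:
  assumes d: "1 \<le> d" "d < a" and "m \<le> N"
  shows "binomial_peak N (real d / real a) \<le> real a * row_peak a m + peak_error a m"
proof -
  define p var where "p = real d / real a" and "var = digit_variance a"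
  have p: "0 < p" "p < 1" using d by (auto simp: p_def)
  have var: "0 < var" "var \<le> p * (1 - p)"
    using d digit_variance_le[OF d] by (auto simp: var_def p_def digit_variance_def)
  show ?thesis
  proof (cases "m = 0")
    case True
    have "p * (1 - p) \<le> 1 * 1" using p by (intro mult_mono) auto
    hence "1 \<le> var powr (-3/2)" using var powr_mono'[of "-3/2" 0 var] by simp
    hence "1 \<le> real a * row_peak a m + peak_error a m"
      using True by (simp add: row_peak_def peak_error_def var_def)
    thus ?thesis using binomial_peak_bounds[of N p] by (simp add: p_def)
  next
    case False
    have "binomial_peak N p \<le> gaussian_peak (real N * (p * (1 - p)))
        + 32 * ((real N + 1) * (p * (1 - p))) powr (-3/2)"
      using binomial_peak_approx[OF p, of N] by (simp add: abs_le_iff mult.assoc)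
    also have "\<dots> \<le> gaussian_peak (real m * var) + 32 * ((real m + 1) * var) powr (-3/2)"
      unfolding gaussian_peak_def using False \<open>m \<le> N\<close> p var
      by (intro add_mono divide_left_mono mult_left_mono real_sqrt_le_mono mult_mono powr_mono2'
          mult_pos_pos) auto
    finally show ?thesis
      using d by (simp add: row_peak_eq_gaussian_peak peak_error_def p_def var_def)
  qed
qed

lemma digit_in_unit_interval:
  assumes "d \<le> a"
  shows "0 \<le> real d / real a" "real d / real a \<le> 1"
  using assms by (auto simp: divide_le_eq_1)

lemma is_pgf_digit: "d < a \<Longrightarrow> is_pgf (digit_pgf a d r s)"
  unfolding digit_pgf_def
  by (intro is_pgf_mult is_pgf_power is_pgf_bernoulli digit_in_unit_interval) auto

lemma pgf_mean_digit:
  assumes "d < a"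
  shows "pgf_mean (digit_pgf a d r s) = (real r + real (r + s) * real d) / real a"
proof -
  have "pgf_mean (digit_pgf a d r s) =
      real r * (real (Suc d) / real a) + real s * (real d / real a)"
    unfolding digit_pgf_def using assms
    by (simp add: pgf_mean_mult pgf_mean_power pgf_mean_bernoulli is_pgf_power
        is_pgf_bernoulli digit_in_unit_interval del: of_nat_Suc)
  also have "\<dots> = (real r + real (r + s) * real d) / real a"
    by (simp add: add_divide_distrib algebra_simps)
  finally show ?thesis .
qed

lemma pgf_variance_digit_le:
  assumes "d < a"
  shows "pgf_variance (digit_pgf a d r s) \<le> real (r + s) / 4"
proof -
  have quarter: "q * (1 - q) \<le> 1 / 4" for q :: real
    using zero_le_power2[of "q - 1/2"] by (simp add: power2_eq_square algebra_simps)
  have "pgf_variance (digit_pgf a d r s) =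
      real r * (real (Suc d) / real a * (1 - real (Suc d) / real a))
      + real s * (real d / real a * (1 - real d / real a))"
    unfolding digit_pgf_def using assms
    by (simp add: pgf_variance_mult pgf_variance_power pgf_variance_bernoulli is_pgf_power
        is_pgf_bernoulli digit_in_unit_interval del: of_nat_Suc)
  also have "\<dots> \<le> real r * (1 / 4) + real s * (1 / 4)"
    by (intro add_mono mult_left_mono quarter) auto
  finally show ?thesis by simp
qed

lemma coeff_bernoulli_pgf_power_le_row_peak:
  assumes "1 \<le> d" "d < a" "m \<le> N"
  shows "coeff (bernoulli_pgf (real d / real a) ^ N) i \<le> real a * row_peak a m + peak_error a m"
proof -
  have "coeff (bernoulli_pgf (real d / real a) ^ N) i = pmf (binomial_pmf N (real d / real a)) i"
    using assms by (intro coeff_bernoulli_pgf_power digit_in_unit_interval) auto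
  also have "\<dots> \<le> binomial_peak N (real d / real a)"
    using assms by (intro pmf_binomial_le_peak digit_in_unit_interval) auto
  also have "\<dots> \<le> real a * row_peak a m + peak_error a m"
    using assms by (rule binomial_peak_le_row_peak)
  finally show ?thesis .
qed

lemma coeff_digit_pgf_le:
  assumes "2 \<le> a" "d < a"
  shows "coeff (digit_pgf a d r s) c \<le> real a * row_peak a (min r s) + peak_error a (min r s)"
proof (cases "d = 0")
  case True
  thus ?thesis
    unfolding digit_pgf_def using assms
    by (intro coeff_mult_pgf_le coeff_bernoulli_pgf_power_le_row_peak
        is_pgf_power is_pgf_bernoulli) auto
next
  case False
  thus ?thesis
    unfolding digit_pgf_def using assms
    by (subst mult.commute, intro coeff_mult_pgf_le coeff_bernoulli_pgf_power_le_row_peak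
        is_pgf_power is_pgf_bernoulli digit_in_unit_interval) auto
qed

text \<open>
  The means of two components differ by at least \<open>(r + s) / a\<close>, so any given entry is far from
  at least one of them.
\<close>

lemma coeff_digit_pgf_small:
  assumes d: "d < a" "d' < a" "d \<noteq> d'" and "0 < r + s"
  shows "coeff (digit_pgf a d r s) c \<le> (real a)\<^sup>2 / real (r + s) \<or>
    coeff (digit_pgf a d' r s) c \<le> (real a)\<^sup>2 / real (r + s)"
proof -
  define t where "t = real (r + s) / (2 * real a)"
  define \<mu> where "\<mu> e = pgf_mean (digit_pgf a e r s)" for e
  have t: "0 < t" using assms by (simp add: t_def del: of_nat_add)
  have small: "coeff (digit_pgf a e r s) c \<le> (real a)\<^sup>2 / real (r + s)"
    if "e < a" "t \<le> \<bar>real c - \<mu> e\<bar>" for e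
  proof -
    have "coeff (digit_pgf a e r s) c \<le> pgf_variance (digit_pgf a e r s) / t\<^sup>2"
      using that t by (intro coeff_pgf_chebyshev is_pgf_digit) (auto simp: \<mu>_def)
    also have "\<dots> \<le> (real (r + s) / 4) / t\<^sup>2"
      using that by (intro divide_right_mono pgf_variance_digit_le) auto
    also have "\<dots> = (real a)\<^sup>2 / real (r + s)"
      using assms by (simp add: t_def power2_eq_square)
    finally show ?thesis .
  qed
  have "\<mu> d - \<mu> d' = 2 * t * (real d - real d')"
    using d by (simp add: \<mu>_def pgf_mean_digit t_def field_simps)
  hence "\<bar>\<mu> d - \<mu> d'\<bar> = 2 * t * \<bar>real d - real d'\<bar>"
    using t by (simp add: abs_mult)
  moreover have "1 \<le> \<bar>real d - real d'\<bar>"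
    using d(3) by (cases d d' rule: linorder_cases) auto
  ultimately have "2 * t \<le> \<bar>\<mu> d - \<mu> d'\<bar>"
    using t by simp
  hence "t \<le> \<bar>real c - \<mu> d\<bar> \<or> t \<le> \<bar>real c - \<mu> d'\<bar>"
    by linarith
  thus ?thesis using small d by blast
qed

lemma sum_le_if_pairwise_small:
  fixes f :: "'a \<Rightarrow> real"
  assumes "finite A" "\<And>x. x \<in> A \<Longrightarrow> f x \<le> B"
    and small: "\<And>x y. x \<in> A \<Longrightarrow> y \<in> A \<Longrightarrow> x \<noteq> y \<Longrightarrow> f x \<le> K \<or> f y \<le> K"
    and "0 \<le> B" "0 \<le> K"
  shows "sum f A \<le> B + real (card A) * K"
proof (cases "\<exists>x\<in>A. \<not> f x \<le> K")
  case True
  then obtain x where x: "x \<in> A" "\<not> f x \<le> K" by blast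
  have "sum f A = f x + sum f (A - {x})"
    using assms(1) x(1) by (rule sum.remove)
  also have "\<dots> \<le> B + (\<Sum>y\<in>A - {x}. K)"
    using assms(2) small x by (intro add_mono sum_mono) auto
  also have "\<dots> \<le> B + (\<Sum>y\<in>A. K)"
    using assms by (intro add_left_mono sum_mono2) auto
  finally show ?thesis by simp
next
  case False
  hence "sum f A \<le> (\<Sum>x\<in>A. K)" by (intro sum_mono) auto
  thus ?thesis using assms by simp
qed

lemma coeff_shuffle_pgf_le:
  assumes "2 \<le> a" "0 < r + s"
  shows "coeff (shuffle_pgf a r s) c
      \<le> row_peak a (min r s) + peak_error a (min r s) + (real a)\<^sup>2 / real (r + s)"
proof -
  define B where "B = real a * row_peak a (min r s) + peak_error a (min r s)"
  have "(\<Sum>d<a. coeff (digit_pgf a d r s) c) \<le> B + real (card {..<a}) * ((real a)\<^sup>2 / real (r + s))"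
  proof (rule sum_le_if_pairwise_small)
    show "coeff (digit_pgf a d r s) c \<le> B" if "d \<in> {..<a}" for d
      unfolding B_def using assms that by (intro coeff_digit_pgf_le) auto
    show "0 \<le> B" using assms by (simp add: B_def row_peak_nonneg peak_error_nonneg)
  qed (use assms coeff_digit_pgf_small in auto)
  hence "coeff (shuffle_pgf a r s) c \<le> (B + real a * ((real a)\<^sup>2 / real (r + s))) / real a"
    unfolding coeff_shuffle_pgf by (intro divide_right_mono) auto
  also have "\<dots> = row_peak a (min r s) + peak_error a (min r s) / real a + (real a)\<^sup>2 / real (r + s)"
    using assms(1) by (simp add: B_def add_divide_distrib)
  also have "\<dots> \<le> row_peak a (min r s) + peak_error a (min r s) / 1 + (real a)\<^sup>2 / real (r + s)"
    using assms(1) peak_error_nonneg by (intro add_left_mono add_right_mono divide_left_mono) auto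
  finally show ?thesis by simp
qed

lemma digit_pgf_attains_binomial_peak:
  assumes "2 \<le> a"
  obtains d c p where "d < a" "c \<le> r + s" "p * (1 - p) = digit_variance a"
    "coeff (digit_pgf a d r s) c = binomial_peak (min r s) p"
proof (cases "r \<le> s")
  case True
  obtain c where c: "c \<le> r" "binomial_peak r (1 / real a) = pmf (binomial_pmf r (1 / real a)) c"
    using binomial_peak_attained by blast
  show thesis
  proof (rule that)
    show "coeff (digit_pgf a 0 r s) c = binomial_peak (min r s) (1 / real a)"
      using assms True c digit_in_unit_interval[of 1 a]
      by (simp add: digit_pgf_def coeff_bernoulli_pgf_power bernoulli_pgf_def [of 0] pCons_one)
    show "1 / real a * (1 - 1 / real a) = digit_variance a"
      using assms by (simp add: digit_variance_def field_simps power2_eq_square)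
  qed (use assms c in auto)
next
  case False
  define p where "p = real (a - 1) / real a"
  obtain c where c: "c \<le> s" "binomial_peak s p = pmf (binomial_pmf s p) c"
    using binomial_peak_attained by blast
  show thesis
  proof (rule that)
    have "digit_pgf a (a - 1) r s = monom 1 r * bernoulli_pgf p ^ s"
      using assms by (simp add: digit_pgf_def p_def bernoulli_pgf_def [of 1] monom_altdef)
    thus "coeff (digit_pgf a (a - 1) r s) (r + c) = binomial_peak (min r s) p"
      using False c digit_in_unit_interval[of "a - 1" a]
      by (simp add: coeff_monom_mult coeff_bernoulli_pgf_power p_def)
    show "p * (1 - p) = digit_variance a"
      using assms by (simp add: digit_variance_def p_def of_nat_diff field_simps power2_eq_square)
  qed (use assms c in auto)
qed

lemma coeff_shuffle_pgf_ge:
  assumes "2 \<le> a"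
  shows "\<exists>c\<le>r + s. row_peak a (min r s) - peak_error a (min r s) \<le> coeff (shuffle_pgf a r s) c"
proof -
  obtain d c p where d: "d < a" "c \<le> r + s" and p: "p * (1 - p) = digit_variance a"
    and coeff: "coeff (digit_pgf a d r s) c = binomial_peak (min r s) p"
    using digit_pgf_attains_binomial_peak[OF assms] .
  have "row_peak a (min r s) - peak_error a (min r s) / 1
      \<le> row_peak a (min r s) - peak_error a (min r s) / real a"
    using assms peak_error_nonneg by (intro diff_left_mono divide_left_mono) auto
  also have "\<dots> = (real a * row_peak a (min r s) - peak_error a (min r s)) / real a"
    using assms by (simp add: diff_divide_distrib)
  also have "\<dots> \<le> coeff (digit_pgf a d r s) c / real a"
    unfolding coeff using binomial_peak_approx_row_peak[OF assms p, of "min r s"]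
    by (intro divide_right_mono) (auto simp: abs_le_iff)
  also have "\<dots> \<le> coeff (shuffle_pgf a r s) c"
    unfolding coeff_shuffle_pgf using d is_pgf_digit
    by (intro divide_right_mono member_le_sum) (auto simp: is_pgf_def)
  finally show ?thesis using d(2) by auto
qed

lemma Max_coeff_shuffle_pgf_approx:
  assumes "2 \<le> a" "2 \<le> n" "r < n"
  shows "\<bar>Max (coeff (shuffle_pgf a r (n - 1 - r)) ` {..<n}) - row_peak a (min r (n - 1 - r))\<bar>
    \<le> peak_error a (min r (n - 1 - r)) + (real a)\<^sup>2 / real (n - 1)"
proof -
  define s where "s = n - 1 - r"
  have rs: "r + s = n - 1" "0 < r + s" using assms by (auto simp: s_def)
  have "Max (coeff (shuffle_pgf a r s) ` {..<n})
      \<le> row_peak a (min r s) + peak_error a (min r s) + (real a)\<^sup>2 / real (n - 1)"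
    using assms coeff_shuffle_pgf_le[OF assms(1) rs(2)] by (intro Max.boundedI) (auto simp: rs)
  moreover have "row_peak a (min r s) - peak_error a (min r s)
      \<le> Max (coeff (shuffle_pgf a r s) ` {..<n})"
  proof -
    obtain c where c: "c \<le> r + s"
      "row_peak a (min r s) - peak_error a (min r s) \<le> coeff (shuffle_pgf a r s) c"
      using coeff_shuffle_pgf_ge[OF assms(1)] by blast
    have "coeff (shuffle_pgf a r s) c \<le> Max (coeff (shuffle_pgf a r s) ` {..<n})"
      using c(1) assms rs by (intro Max_ge) auto
    with c(2) show ?thesis by (rule order_trans)
  qed
  ultimately show ?thesis
    unfolding s_def [symmetric] by (simp add: abs_le_iff add_increasing2)
qed

section \<open>Summation over the rows\<close>

lemma sum_min_reflect:
  fixes h :: "nat \<Rightarrow> 'a :: comm_monoid_add"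
  shows "(\<Sum>r<n. h (min r (n - 1 - r))) = (\<Sum>l<n. h (l div 2))"
proof (induction n arbitrary: h rule: induct_nat_012)
  case (ge2 n)
  have "(\<Sum>r<Suc (Suc n). h (min r (Suc (Suc n) - 1 - r))) =
      h 0 + ((\<Sum>r<n. h (min (Suc r) (n - r))) + h 0)"
    by (subst sum.lessThan_Suc_shift) simp
  also have "(\<Sum>r<n. h (min (Suc r) (n - r))) = (\<Sum>r<n. h (Suc (min r (n - 1 - r))))"
    by (intro sum.cong refl arg_cong[of _ _ h]) auto
  also have "\<dots> = (\<Sum>l<n. h (Suc (l div 2)))"
    by (rule ge2.IH(1))
  also have "h 0 + (\<dots> + h 0) = (\<Sum>l<Suc (Suc n). h (l div 2))"
    unfolding sum.lessThan_Suc_shift by (simp add: add_ac)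
  finally show ?case .
qed simp_all

lemma sum_min_reflect_le_suminf:
  fixes h :: "nat \<Rightarrow> real"
  assumes "summable h" "\<And>m. 0 \<le> h m"
  shows "(\<Sum>r<n. h (min r (n - 1 - r))) \<le> 2 * suminf h"
proof -
  have "(\<Sum>r<n. h (min r (n - 1 - r))) \<le> (\<Sum>l<2 * n. h (l div 2))"
    unfolding sum_min_reflect using assms(2) by (intro sum_mono2) auto
  also have "\<dots> = 2 * (\<Sum>m<n. h m)"
    by (simp add: sum_lessThan_double sum_distrib_left)
  also have "\<dots> \<le> 2 * suminf h"
    using assms by (intro mult_left_mono sum_le_suminf) auto
  finally show ?thesis .
qed

lemma summable_peak_error: "summable (peak_error a)"
proof -
  have "0 \<le> digit_variance a" by (cases a) (auto simp: digit_variance_def)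
  hence "peak_error a = (\<lambda>m. 32 * digit_variance a powr (-3/2) * real (Suc m) powr (-3/2))"
    unfolding peak_error_def by (intro ext) (simp add: powr_mult add_ac mult_ac)
  moreover have "summable (\<lambda>m. real m powr (-3/2))"
    by (simp add: summable_real_powr_iff)
  hence "summable (\<lambda>m. real (Suc m) powr (-3/2))"
    by (rule summable_Suc_iff [THEN iffD2])
  ultimately show ?thesis
    by (simp only: summable_mult)
qed

lemma inverse_sqrt_telescope:
  fixes x :: real
  assumes "0 \<le> x"
  shows "1 / sqrt (x + 1) \<le> 2 * (sqrt (x + 1) - sqrt x)"
    and "0 < x \<Longrightarrow> 2 * (sqrt (x + 1) - sqrt x) \<le> 1 / sqrt x"
proof -
  have "(sqrt (x + 1) - sqrt x) * (sqrt (x + 1) + sqrt x) = 1"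
    using assms by (simp add: algebra_simps)
  hence eq: "sqrt (x + 1) - sqrt x = 1 / (sqrt (x + 1) + sqrt x)"
    using assms by (simp add: eq_divide_eq add_nonneg_eq_0_iff)
  have "1 / sqrt (x + 1) = 2 * (1 / (2 * sqrt (x + 1)))" by simp
  also have "\<dots> \<le> 2 * (1 / (sqrt (x + 1) + sqrt x))"
    using assms
    by (intro mult_left_mono divide_left_mono) (auto intro!: mult_pos_pos add_pos_nonneg)
  finally show "1 / sqrt (x + 1) \<le> 2 * (sqrt (x + 1) - sqrt x)" by (simp only: eq)
  show "2 * (sqrt (x + 1) - sqrt x) \<le> 1 / sqrt x" if "0 < x"
  proof -
    have "2 * (1 / (sqrt (x + 1) + sqrt x)) \<le> 2 * (1 / (2 * sqrt x))"
      using that by (intro mult_left_mono divide_left_mono) (auto intro!: mult_pos_pos add_pos_pos)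
    thus ?thesis by (simp add: eq)
  qed
qed

lemma sum_inverse_sqrt_le: "(\<Sum>m\<le>M. 1 / sqrt (real m)) \<le> 2 * sqrt (real M)"
proof (induction M)
  case (Suc M)
  thus ?case using inverse_sqrt_telescope(1)[of "real M"] by (simp add: add_ac)
qed simp

lemma sum_inverse_sqrt_ge: "2 * sqrt (real M) - 2 \<le> (\<Sum>m<M. 1 / sqrt (real m))"
proof (induction M)
  case (Suc M)
  show ?case
  proof (cases "M = 0")
    case False
    thus ?thesis using Suc inverse_sqrt_telescope(2)[of "real M"] by (simp add: add_ac)
  qed simp
qed simp

lemma sum_min_reflect_inverse_sqrt:
  "\<bar>(\<Sum>r<n. 1 / sqrt (real (min r (n - 1 - r)))) - 2 * sqrt (2 * real n)\<bar> \<le> 8"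
proof -
  define F where "F n = (\<Sum>l<n. 1 / sqrt (real (l div 2)))" for n
  define q where "q = n div 2"
  have F_double: "F (2 * M) = 2 * (\<Sum>m<M. 1 / sqrt (real m))" for M
    by (simp add: F_def sum_lessThan_double sum_distrib_left)
  have F_mono: "F i \<le> F j" if "i \<le> j" for i j
    unfolding F_def using that by (intro sum_mono2) auto
  have "F n \<le> F (2 * Suc q)" by (intro F_mono) (simp add: q_def)
  also have "\<dots> \<le> 2 * sqrt (4 * real q)"
    using sum_inverse_sqrt_le[of q]
    by (simp only: F_double lessThan_Suc_atMost real_sqrt_mult real_sqrt_four)
  also have "\<dots> \<le> 2 * sqrt (2 * real n)"
    by (simp add: q_def)
  finally have upper: "F n \<le> 2 * sqrt (2 * real n)" .
  have "2 * real n \<le> 4 * real q + 4" by (simp add: q_def)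
  also have "\<dots> \<le> (2 * sqrt (real q) + 2)\<^sup>2" by (simp add: power2_sum power_mult_distrib)
  finally have "sqrt (2 * real n) \<le> 2 * sqrt (real q) + 2"
    by (intro real_le_lsqrt) auto
  moreover have "4 * sqrt (real q) - 4 \<le> F (2 * q)"
    using sum_inverse_sqrt_ge[of q] by (simp add: F_double)
  moreover have "F (2 * q) \<le> F n" by (intro F_mono) (simp add: q_def)
  ultimately have "2 * sqrt (2 * real n) - 8 \<le> F n" by linarith
  with upper show ?thesis
    unfolding F_def sum_min_reflect[of "\<lambda>m. 1 / sqrt (real m)"] by linarith
qed

lemma sum_row_peak:
  assumes "2 \<le> a"
  shows "\<bar>(\<Sum>r<n. row_peak a (min r (n - 1 - r))) - 2 * sqrt (real n) / sqrt ((real a - 1) * pi)\<bar>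
    \<le> 8"
proof -
  define A where "A = sqrt (2 * pi * (real a - 1))"
  have "1 * 1 \<le> (2 * pi) * (real a - 1)"
    using assms pi_ge_two by (intro mult_mono) auto
  hence A: "1 \<le> A" by (simp add: A_def)
  have "(\<Sum>r<n. row_peak a (min r (n - 1 - r))) = (\<Sum>r<n. 1 / sqrt (real (min r (n - 1 - r)))) / A"
    by (simp add: row_peak_def A_def real_sqrt_mult sum_divide_distrib mult_ac)
  moreover have "2 * sqrt (real n) / sqrt ((real a - 1) * pi) = 2 * sqrt (2 * real n) / A"
    by (simp add: A_def real_sqrt_mult)
  ultimately have "\<bar>(\<Sum>r<n. row_peak a (min r (n - 1 - r)))
        - 2 * sqrt (real n) / sqrt ((real a - 1) * pi)\<bar> =
      \<bar>(\<Sum>r<n. 1 / sqrt (real (min r (n - 1 - r)))) - 2 * sqrt (2 * real n)\<bar> / A"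
    using A by (simp add: abs_divide flip: diff_divide_distrib)
  also have "\<dots> \<le> 8 / 1"
    using A sum_min_reflect_inverse_sqrt by (intro frac_le) auto
  finally show ?thesis by simp
qed

lemma expected_score_approx:
  assumes "k \<ge> 1" "n \<ge> 2"
  shows "\<bar>expected_score k n - (\<Sum>r<n. row_peak (2 ^ k) (min r (n - 1 - r)))\<bar>
    \<le> 2 * suminf (peak_error (2 ^ k)) + 2 * (2 ^ k)\<^sup>2"
proof -
  define a :: nat where "a = 2 ^ k"
  define M where "M r = Max (coeff (shuffle_pgf a r (n - 1 - r)) ` {..<n})" for r
  have a: "2 \<le> a" using assms(1) power_increasing[of 1 k "2::nat"] by (simp add: a_def)
  have "\<bar>expected_score k n - (\<Sum>r<n. row_peak a (min r (n - 1 - r)))\<bar> =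
      \<bar>\<Sum>r<n. M r - row_peak a (min r (n - 1 - r))\<bar>"
    by (simp add: expected_score_eq_sum_Max M_def a_def sum_subtractf)
  also have "\<dots> \<le> (\<Sum>r<n. peak_error a (min r (n - 1 - r)) + (real a)\<^sup>2 / real (n - 1))"
    unfolding M_def using a assms(2)
    by (intro order_trans[OF sum_abs] sum_mono Max_coeff_shuffle_pgf_approx) auto
  also have "\<dots> \<le> 2 * suminf (peak_error a) + real n * ((real a)\<^sup>2 / real (n - 1))"
    using sum_min_reflect_le_suminf[OF summable_peak_error peak_error_nonneg]
    by (simp only: sum.distrib sum_constant card_lessThan add_le_cancel_right)
  also have "real n * ((real a)\<^sup>2 / real (n - 1)) = real n / real (n - 1) * (real a)\<^sup>2"
    by simp
  also have "\<dots> \<le> 2 * (real a)\<^sup>2"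
    using assms(2) by (intro mult_right_mono) (auto simp: of_nat_diff field_simps)
  finally show ?thesis by (simp add: a_def)
qed

theorem theorem9:
  fixes k :: nat
  assumes "k \<ge> 1"
  shows "(\<lambda>n::nat. expected_score k n - 2 * sqrt (real n) / sqrt ((2 ^ k - 1) * pi)) \<in> O(\<lambda>_. 1)"
proof -
  define g where "g n = (\<Sum>r<n. row_peak (2 ^ k) (min r (n - 1 - r)))" for n
  have "(\<lambda>n. expected_score k n - g n) \<in> O(\<lambda>_. 1)"
    using eventually_mono[OF eventually_ge_at_top[of 2] expected_score_approx[OF assms]]
    by (intro bigoI) (simp add: g_def)
  moreover have "2 \<le> (2 ^ k :: nat)"
    using assms power_increasing[of 1 k "2::nat"] by simp
  hence "(\<lambda>n. g n - 2 * sqrt (real n) / sqrt ((2 ^ k - 1) * pi)) \<in> O(\<lambda>_. 1)"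
    using sum_row_peak[of "2 ^ k"] by (intro bigoI[where c = 8]) (simp add: g_def)
  ultimately have "(\<lambda>n. (expected_score k n - g n)
      + (g n - 2 * sqrt (real n) / sqrt ((2 ^ k - 1) * pi))) \<in> O(\<lambda>_. 1)"
    by (rule sum_in_bigo)
  thus ?thesis by simp
qed

end
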